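(* Let $(\mathfrak g,\mathfrak v,\pi)$ be a Lorentzian data set. Decompose $\mathfrak g=\mathfrak g'\oplus\mathfrak c$, where $\mathfrak g'=[\mathfrak g,\mathfrak g]$ is compact and semisimple and $\mathfrak c$ is the center of $\mathfrak g$, and write $\mathfrak h^{\mathrm{aut}}=\mathfrak u\oplus\mathfrak g'$ where $\mathfrak u=\{(A,B)\in\mathfrak h^{\mathrm{aut}}:A|_{\mathfrak g'}=0\}$. Then, identifying $B\in\mathfrak{so}(\mathfrak v)$ with the pair $(0,B)$, $$\mathfrak u=\mathrm{End}_\pi(\mathfrak v)\cap\mathfrak{so}(\mathfrak v)=\{B\in\mathfrak{so}(\mathfrak v):[B,\pi(Z)]=0\text{ for every }Z\in\mathfrak g\}.$$
   Context: A metric on a real vector space is a non-degenerate symmetric bilinear form; Lorentzian means exactly one negative direction; $\mathfrak{so}$ denotes skew-symmetric endomorphisms. A Lorentzian data set is a triple $(\mathfrak g,\mathfrak v,\pi)$ where $\mathfrak g$ is a (finite-dimensional real) Lie algebra with an $\mathrm{ad}$-invariant metric $\langle\cdot,\cdot\rangle_{\mathfrak g}$ (each $\mathrm{ad}_Z$ is skew-symmetric), $\mathfrak v$ is a real vector space with a metric $\langle\cdot,\cdot\rangle_{\mathfrak v}$, and $\pi:\mathfrak g\to\mathfrak{so}(\mathfrak v,\langle\cdot,\cdot\rangle_{\mathfrak v})$ is a faithful representation with $\bigcap_{Z\in\mathfrak g}\ker\pi(Z)=\{0\}$, such that the orthogonal direct sum metric on $\mathfrak g\oplus\mathfrak v$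 is Lorentzian. For such a data set $\mathfrak g$ is a compact Lie algebra, so $\mathfrak g=\mathfrak g'\oplus\mathfrak c$. $\mathfrak n=\mathfrak n(\mathfrak g,\mathfrak v,\pi)=\mathfrak g\oplus\mathfrak v$ is the metric Lie algebra with the orthogonal direct sum metric and bracket $[\mathfrak g,\mathfrak n]=0$, $[\mathfrak v,\mathfrak v]\subset\mathfrak g$, $\langle[X,Y],Z\rangle=\langle\pi(Z)X,Y\rangle$ for $X,Y\in\mathfrak v$, $Z\in\mathfrak g$. $\mathfrak h^{\mathrm{aut}}$ is the Lie algebra of skew-symmetric derivations of $\mathfrak n$; equivalently $$\mathfrak h^{\mathrm{aut}}=\{(A,B)\in\mathfrak{so}(\mathfrak g,\langle\cdot,\cdot\rangle_{\mathfrak g})\times\mathfrak{so}(\mathfrak v,\langle\cdot,\cdot\rangle_{\mathfrak v}):[B,\pi(Z)]=\pi(AZ)\text{ for every }Z\in\mathfrak g\},$$ acting componentwise on $\mathfrak g\oplus\mathfrak v$. In $\mathfrak h^{\mathrm{aut}}=\mathfrak u\oplus\mathfrak g'$, the summand $\mathfrak g'$ is embedded by $Z\mapsto(\mathrm{ad}(Z),\pi(Z))$. $\mathrm{End}_\pi(\mathfrak v)$ is the space of $B\in\mathrm{End}(\mathfrak v)$ with $[B,\pi(Z)]=0$ for all $Z\in\mathfrak g$. *)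

theory Defs
  imports "HOL-Analysis.Analysis"
begin

section \<open>Metrics on finite-dimensional real vector spaces\<close>

definition finite_dim :: "'a::real_vector itself \<Rightarrow> bool" where
  "finite_dim _ \<longleftrightarrow> (\<exists>B :: 'a set. finite B \<and> span B = UNIV)"

definition is_metric :: "('a::real_vector \<Rightarrow> 'a \<Rightarrow> real) \<Rightarrow> bool" where
  "is_metric b \<longleftrightarrow>
     bilinear b \<and> (\<forall>x y. b x y = b y x) \<and> (\<forall>x. (\<forall>y. b x y = 0) \<longrightarrow> x = 0)"

definition negative_definite_on ::
  "('a::real_vector \<Rightarrow> 'a \<Rightarrow> real) \<Rightarrow> 'a set \<Rightarrow> bool" where
  "negative_definite_on b S \<longleftrightarrow> subspace S \<and> (\<forall>x\<in>S. x \<noteq> 0 \<longrightarrow> b x x < 0)"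

text \<open>Exactly one negative direction: the maximal dimension of a negative definite subspace
  (the index of the metric) is one.  Only used in finite dimension, since \<^const>\<open>dim\<close> of an
  infinite-dimensional subspace is \<open>0\<close>.\<close>

definition lorentzian :: "('a::real_vector \<Rightarrow> 'a \<Rightarrow> real) \<Rightarrow> bool" where
  "lorentzian b \<longleftrightarrow> is_metric b \<and>
     (\<exists>S. negative_definite_on b S \<and> dim S = 1) \<and>
     (\<forall>S. negative_definite_on b S \<longrightarrow> dim S \<le> 1)"

definition so :: "('a::real_vector \<Rightarrow> 'a \<Rightarrow> real) \<Rightarrow> ('a \<Rightarrow> 'a) set" where
  "so b = {T. linear T \<and> (\<forall>x y. b (T x) y = - b x (T y))}"

definition orthogonal_sum ::
  "('a::real_vector \<Rightarrow> 'a \<Rightarrow> real) \<Rightarrow> ('b::real_vector \<Rightarrow> 'b \<Rightarrow> real) \<Rightarrow>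
     'a \<times> 'b \<Rightarrow> 'a \<times> 'b \<Rightarrow> real" where
  "orthogonal_sum b c = (\<lambda>(Z, X) (W, Y). b Z W + c X Y)"

definition commutator :: "('a::real_vector \<Rightarrow> 'a) \<Rightarrow> ('a \<Rightarrow> 'a) \<Rightarrow> 'a \<Rightarrow> 'a" where
  "commutator S T = (\<lambda>x. S (T x) - T (S x))"


section \<open>Lorentzian data sets\<close>

locale lie_algebra =
  fixes br :: "'g::real_vector \<Rightarrow> 'g \<Rightarrow> 'g"
  assumes bilinear_br: "bilinear br"
    and br_self: "br Z Z = 0"
    and jacobi: "br X (br Y Z) + br Y (br Z X) + br Z (br X Y) = 0"

locale lorentzian_data_set = lie_algebra br
  for br :: "'g::real_vector \<Rightarrow> 'g \<Rightarrow> 'g" +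
  fixes gg :: "'g \<Rightarrow> 'g \<Rightarrow> real"
    and gv :: "'v::real_vector \<Rightarrow> 'v \<Rightarrow> real"
    and \<pi> :: "'g \<Rightarrow> 'v \<Rightarrow> 'v"
  assumes finite_dim_g: "finite_dim TYPE('g)"
    and finite_dim_v: "finite_dim TYPE('v)"
    and metric_g: "is_metric gg"
    and metric_v: "is_metric gv"
    and ad_invariant: "br Z \<in> so gg"
    and rep_bilinear: "bilinear \<pi>"
    and rep_so: "\<pi> Z \<in> so gv"
    and rep_bracket: "\<pi> (br Z W) = commutator (\<pi> Z) (\<pi> W)"
    and rep_faithful: "inj \<pi>"
    and rep_no_common_kernel: "(\<Inter>Z. {X. \<pi> Z X = 0}) = {0}"
    and lorentzian_sum: "lorentzian (orthogonal_sum gg gv)"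

definition derived_algebra :: "('g::real_vector \<Rightarrow> 'g \<Rightarrow> 'g) \<Rightarrow> 'g set" where
  "derived_algebra br = span {br Z W | Z W. True}"

definition End_rep :: "('g \<Rightarrow> 'v::real_vector \<Rightarrow> 'v) \<Rightarrow> ('v \<Rightarrow> 'v) set" where
  "End_rep \<pi> = {B. linear B \<and> (\<forall>Z. commutator B (\<pi> Z) = (\<lambda>_. 0))}"


section \<open>The two-step nilpotent metric Lie algebra and its skew-symmetric derivations\<close>

text \<open>The bracket of two elements of the representation space; \<open>vv_bracket_eq\<close> below shows
  that the description is well-defined.\<close>

definition vv_bracket ::
  "('g::real_vector \<Rightarrow> 'g \<Rightarrow> real) \<Rightarrow> ('v::real_vector \<Rightarrow> 'v \<Rightarrow> real) \<Rightarrow> ('g \<Rightarrow> 'v \<Rightarrow> 'v) \<Rightarrow>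
     'v \<Rightarrow> 'v \<Rightarrow> 'g" where
  "vv_bracket gg gv \<pi> X Y = (THE U. \<forall>Z. gg U Z = gv (\<pi> Z X) Y)"

definition n_bracket ::
  "('g::real_vector \<Rightarrow> 'g \<Rightarrow> real) \<Rightarrow> ('v::real_vector \<Rightarrow> 'v \<Rightarrow> real) \<Rightarrow> ('g \<Rightarrow> 'v \<Rightarrow> 'v) \<Rightarrow>
     'g \<times> 'v \<Rightarrow> 'g \<times> 'v \<Rightarrow> 'g \<times> 'v" where
  "n_bracket gg gv \<pi> x y = (vv_bracket gg gv \<pi> (snd x) (snd y), 0)"

definition derivations ::
  "('a::real_vector \<Rightarrow> 'a \<Rightarrow> 'a) \<Rightarrow> ('a \<Rightarrow> 'a) set" where
  "derivations br = {D. linear D \<and> (\<forall>x y. D (br x y) = br (D x) y + br x (D y))}"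

definition h_aut ::
  "('g::real_vector \<Rightarrow> 'g \<Rightarrow> real) \<Rightarrow> ('v::real_vector \<Rightarrow> 'v \<Rightarrow> real) \<Rightarrow> ('g \<Rightarrow> 'v \<Rightarrow> 'v) \<Rightarrow>
     ('g \<times> 'v \<Rightarrow> 'g \<times> 'v) set" where
  "h_aut gg gv \<pi> = so (orthogonal_sum gg gv) \<inter> derivations (n_bracket gg gv \<pi>)"

text \<open>A pair \<open>(A, B)\<close> of endomorphisms is identified with its componentwise action
  \<^term>\<open>map_prod A B\<close>; by \<open>h_aut_eq\<close> below every element of \<^const>\<open>h_aut\<close> is of this form.\<close>

definition u_aut ::
  "('g::real_vector \<Rightarrow> 'g \<Rightarrow> 'g) \<Rightarrow> ('g \<Rightarrow> 'g \<Rightarrow> real) \<Rightarrow> ('v::real_vector \<Rightarrow> 'v \<Rightarrow> real) \<Rightarrow>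
     ('g \<Rightarrow> 'v \<Rightarrow> 'v) \<Rightarrow> (('g \<Rightarrow> 'g) \<times> ('v \<Rightarrow> 'v)) set" where
  "u_aut br gg gv \<pi> =
     {(A, B). map_prod A B \<in> h_aut gg gv \<pi> \<and> (\<forall>Z\<in>derived_algebra br. A Z = 0)}"


section \<open>Well-definedness of the bracket and the componentwise description\<close>

lemma metric_representation:
  fixes b :: "'a::real_vector \<Rightarrow> 'a \<Rightarrow> real"
  assumes "finite_dim TYPE('a)" "is_metric b" "linear f"
  shows "\<exists>!u. \<forall>z. b u z = f z"
proof -
  have bil: "bilinear b" and nd: "\<And>x. (\<forall>y. b x y = 0) \<Longrightarrow> x = 0"
    using assms(2) by (auto simp: is_metric_def)
  obtain C :: "'a set" where C: "finite C" "span C = UNIV"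
    using assms(1) by (auto simp: finite_dim_def)
  obtain B where B: "B \<subseteq> C" "independent B" "C \<subseteq> span B"
    using maximal_independent_subset by blast
  have fB: "finite B" using B(1) C(1) finite_subset by blast
  have sB: "span B = UNIV"
    using B(3) C(2) by (metis span_mono span_span top.extremum_uniqueI)
  interpret fd: finite_dimensional_vector_space "scaleR :: real \<Rightarrow> 'a \<Rightarrow> 'a" B
    by unfold_locales
      (use fB B(2) sB in \<open>auto simp: dependent_raw_def[symmetric] span_raw_def[symmetric]\<close>)
  define L where "L x = (\<Sum>z\<in>B. b x z *\<^sub>R z)" for x
  have lin1: "linear (b x)" and lin2: "linear (\<lambda>x. b x y)" for x y
    using bil by (auto simp: bilinear_def)
  have linL: "linear L"
    unfolding L_def
    by (rule linearI)
      (simp_all add: linear_add[OF lin2] linear_cmul[OF lin2] scaleR_add_left sum.distrib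
        scaleR_sum_right)
  have coeff: "f z = g z"
    if "linear f" "linear g" "\<forall>z\<in>B. f z = g z" for f g :: "'a \<Rightarrow> real" and z
    using linear_eq_on[OF that(1,2), of z B] sB that(3) by auto
  have indep: "c z = d z"
    if "(\<Sum>z\<in>B. c z *\<^sub>R z) = (\<Sum>z\<in>B. d z *\<^sub>R z)" "z \<in> B" for c d :: "'a \<Rightarrow> real" and z
  proof -
    have "(\<Sum>z\<in>B. (c z - d z) *\<^sub>R z) = 0"
      using that(1) by (simp add: scaleR_diff_left sum_subtractf)
    then have "c z - d z = 0"
      using independentD[OF B(2) fB subset_refl, of "\<lambda>z. c z - d z" z] that(2) by simp
    then show ?thesis by simp
  qed
  have "inj L"
  proof (rule injI)
    fix x y assume "L x = L y"
    then have "\<forall>z\<in>B. b x z = b y z" unfolding L_def using indep by blast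
    then have "\<forall>z. b x z = b y z" using coeff[OF lin1 lin1] by blast
    then have "\<forall>z. b (x - y) z = 0" using linear_diff[OF lin2] by simp
    then show "x = y" using nd by force
  qed
  moreover have "Vector_Spaces.linear scaleR scaleR L"
    using linL by (simp add: linear_def)
  ultimately have "surj L" using fd.linear_inj_imp_surj by blast
  then obtain u where "L u = (\<Sum>z\<in>B. f z *\<^sub>R z)" by (metis surjD)
  then have "\<forall>z\<in>B. b u z = f z" unfolding L_def using indep by blast
  then have u: "\<forall>z. b u z = f z" using coeff[OF lin1 assms(3)] by blast
  moreover have "v = u" if "\<forall>z. b v z = f z" for v
  proof -
    have "\<forall>z. b (v - u) z = 0" using linear_diff[OF lin2] u that by simp
    then show ?thesis using nd by force
  qed
  ultimately show ?thesis by blast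
qed

context lorentzian_data_set
begin

lemma bilinear_gg: "bilinear gg" and gg_sym: "gg Z W = gg W Z"
  and gg_nondeg: "(\<And>W. gg Z W = 0) \<Longrightarrow> Z = 0"
  using metric_g by (auto simp: is_metric_def)

lemma bilinear_gv: "bilinear gv" and gv_sym: "gv X Y = gv Y X"
  and gv_nondeg: "(\<And>Y. gv X Y = 0) \<Longrightarrow> X = 0"
  using metric_v by (auto simp: is_metric_def)

lemma vv_bracket_eq: "gg (vv_bracket gg gv \<pi> X Y) Z = gv (\<pi> Z X) Y"
proof -
  have "linear (\<lambda>Z. \<pi> Z X)" using rep_bilinear by (simp add: bilinear_def)
  moreover have "linear (\<lambda>X. gv X Y)" using bilinear_gv by (simp add: bilinear_def)
  ultimately have "linear (\<lambda>Z. gv (\<pi> Z X) Y)"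
    using linear_compose by (fastforce simp: o_def)
  from theI'[OF metric_representation[OF finite_dim_g metric_g this]]
  show ?thesis by (simp add: vv_bracket_def)
qed

lemmas rep_simps =
  bilinear_lzero[OF rep_bilinear] bilinear_rzero[OF rep_bilinear]
  bilinear_lzero[OF bilinear_gg] bilinear_rzero[OF bilinear_gg]
  bilinear_ladd[OF bilinear_gg] bilinear_lsub[OF bilinear_gg]
  bilinear_lzero[OF bilinear_gv] bilinear_rzero[OF bilinear_gv]
  bilinear_ladd[OF bilinear_gv] bilinear_lsub[OF bilinear_gv]

lemma gg_eqI: "(\<And>Z. gg U Z = gg V Z) \<Longrightarrow> U = V"
  using gg_nondeg[of "U - V"] by (simp add: rep_simps)

lemma gv_eqI: "(\<And>Y. gv U Y = gv V Y) \<Longrightarrow> U = V"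
  using gv_nondeg[of "U - V"] by (simp add: rep_simps)

lemma vv_bracket_zero: "vv_bracket gg gv \<pi> 0 X = 0" "vv_bracket gg gv \<pi> X 0 = 0"
  by (rule gg_eqI; simp add: vv_bracket_eq rep_simps)+

lemma map_prod_in_so:
  "map_prod A B \<in> so (orthogonal_sum gg gv) \<longleftrightarrow> A \<in> so gg \<and> B \<in> so gv"
proof
  assume L: "map_prod A B \<in> so (orthogonal_sum gg gv)"
  then have lin: "linear (map_prod A B)"
    and sk: "\<And>Z X W Y. gg (A Z) W + gv (B X) Y = - (gg Z (A W) + gv X (B Y))"
    by (auto simp: so_def orthogonal_sum_def)
  have 0: "A 0 = 0" "B 0 = 0"
    using linear_0[OF lin] by (auto simp: zero_prod_def)
  have "linear A"
    using linear_add[OF lin, of "(_, 0)" "(_, 0)"] linear_cmul[OF lin, of _ "(_, 0)"]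
    by (intro linearI) auto
  moreover have "linear B"
    using linear_add[OF lin, of "(0, _)" "(0, _)"] linear_cmul[OF lin, of _ "(0, _)"]
    by (intro linearI) auto
  moreover have "gg (A Z) W = - gg Z (A W)" for Z W
    using sk[of Z W 0 0] by (simp add: 0 rep_simps)
  moreover have "gv (B X) Y = - gv X (B Y)" for X Y
    using sk[of 0 0 X Y] by (simp add: 0 rep_simps)
  ultimately show "A \<in> so gg \<and> B \<in> so gv" by (auto simp: so_def)
next
  assume R: "A \<in> so gg \<and> B \<in> so gv"
  then have A: "linear A" and B: "linear B" by (auto simp: so_def)
  have "linear (map_prod A B)"
    by (rule linearI)
      (auto simp: linear_add[OF A] linear_add[OF B] linear_cmul[OF A] linear_cmul[OF B])
  then show "map_prod A B \<in> so (orthogonal_sum gg gv)"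
    using R by (auto simp: so_def orthogonal_sum_def)
qed

lemma map_prod_in_h_aut:
  "map_prod A B \<in> h_aut gg gv \<pi> \<longleftrightarrow>
     A \<in> so gg \<and> B \<in> so gv \<and> (\<forall>Z. commutator B (\<pi> Z) = \<pi> (A Z))"
proof (cases "A \<in> so gg \<and> B \<in> so gv")
  case True
  then have skA: "\<And>Z W. gg (A Z) W = - gg Z (A W)" and skB: "\<And>X Y. gv (B X) Y = - gv X (B Y)"
    and linB: "linear B" by (auto simp: so_def)
  have lin: "linear (map_prod A B)"
    using True map_prod_in_so by (auto simp: so_def)
  let ?b = "vv_bracket gg gv \<pi>"
  have eq: "gg (A (?b X Y)) Z = gg (?b (B X) Y + ?b X (B Y)) Z \<longleftrightarrow>
      gv (commutator B (\<pi> Z) X) Y = gv (\<pi> (A Z) X) Y" for X Y Z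
    by (auto simp: skA vv_bracket_eq rep_simps commutator_def skB)
  have "map_prod A B \<in> derivations (n_bracket gg gv \<pi>) \<longleftrightarrow>
      (\<forall>X Y. A (?b X Y) = ?b (B X) Y + ?b X (B Y))"
    using lin linear_0[OF linB] by (auto simp: derivations_def n_bracket_def)
  also have "\<dots> \<longleftrightarrow> (\<forall>X Y Z. gg (A (?b X Y)) Z = gg (?b (B X) Y + ?b X (B Y)) Z)"
    by (auto intro: gg_eqI)
  also have "\<dots> \<longleftrightarrow> (\<forall>X Y Z. gv (commutator B (\<pi> Z) X) Y = gv (\<pi> (A Z) X) Y)"
    by (simp only: eq)
  also have "\<dots> \<longleftrightarrow> (\<forall>Z. commutator B (\<pi> Z) = \<pi> (A Z))"
    by (auto intro!: ext intro: gv_eqI)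
  finally show ?thesis using True by (simp add: h_aut_def map_prod_in_so)
next
  case False
  then show ?thesis by (auto simp: h_aut_def map_prod_in_so)
qed

lemma h_aut_eq:
  "h_aut gg gv \<pi> =
     {map_prod A B | A B. A \<in> so gg \<and> B \<in> so gv \<and> (\<forall>Z. commutator B (\<pi> Z) = \<pi> (A Z))}"
proof -
  have "\<exists>A B. D = map_prod A B" if D: "D \<in> h_aut gg gv \<pi>" for D
  proof -
    have lin: "linear D"
      and sk: "\<And>x y. orthogonal_sum gg gv (D x) y = - orthogonal_sum gg gv x (D y)"
      and der: "\<And>x y. D (n_bracket gg gv \<pi> x y) = n_bracket gg gv \<pi> (D x) y + n_bracket gg gv \<pi> x (D y)"
      using D by (auto simp: h_aut_def so_def derivations_def)
    have 1: "snd (D (Z, 0)) = 0" for Z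
    proof -
      let ?Y = "snd (D (Z, 0))"
      have "vv_bracket gg gv \<pi> ?Y X = 0" for X
        using der[of "(Z, 0)" "(0, X)"] linear_0[OF lin]
        by (simp add: n_bracket_def vv_bracket_zero zero_prod_def)
      then have "gv (\<pi> U ?Y) X = 0" for U X
        using vv_bracket_eq[of ?Y X U] by (simp add: rep_simps)
      then have "\<pi> U ?Y = 0" for U using gv_nondeg by blast
      then show ?thesis using rep_no_common_kernel by blast
    qed
    have 2: "fst (D (0, X)) = 0" for X
    proof (rule gg_nondeg)
      fix Z
      show "gg (fst (D (0, X))) Z = 0"
        using sk[of "(0, X)" "(Z, 0)"] 1[of Z]
        by (simp add: orthogonal_sum_def case_prod_unfold rep_simps)
    qed
    have 3: "D (Z, X) = map_prod (\<lambda>Z. fst (D (Z, 0))) (\<lambda>X. snd (D (0, X))) (Z, X)" for Z X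
      using linear_add[OF lin, of "(Z, 0)" "(0, X)"] 1[of Z] 2[of X] by (simp add: prod_eq_iff)
    have "D = map_prod (\<lambda>Z. fst (D (Z, 0))) (\<lambda>X. snd (D (0, X)))"
      by (rule ext) (metis 3 surj_pair)
    then show ?thesis by blast
  qed
  then show ?thesis by (auto simp: map_prod_in_h_aut) (metis map_prod_in_h_aut)
qed

end

end

theory Submission
  imports Defs "HOL-Computational_Algebra.Polynomial"
begin

text \<open>For \<open>(A, B)\<close> in \<open>\<uu>\<close> and \<open>Z\<close> in \<open>\<gg>\<close>, skew-symmetry of \<open>A\<close> makes \<open>W = A Z\<close> orthogonal to \<open>\<gg>'\<close>,
  hence central, so \<open>C = \<pi> W = [B, \<pi> Z]\<close> commutes with all of \<open>\<pi> \<gg>\<close>.  Such a commutator is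
  nilpotent.  If \<open>C\<close> were nonzero, its last nonzero power \<open>S\<close> would have a totally null image, which
  is a line because the index is one.  Each \<open>\<pi> U\<close> commutes with \<open>S\<close>, so it scales this line, and by
  skew-symmetry the factor is zero: the line lies in the common kernel, a contradiction.  So
  \<open>\<pi> (A Z) = 0\<close>, and \<open>A = 0\<close> by faithfulness.\<close>

section \<open>Polynomials in an endomorphism\<close>

text \<open>Horner evaluation of p(D) at the vector x. The fold acts on vectors, so no ring
  structure on endomorphisms is involved.\<close>

definition poly_map :: "real poly \<Rightarrow> ('a::real_vector \<Rightarrow> 'a) \<Rightarrow> 'a \<Rightarrow> 'a" where
  "poly_map p D x = fold_coeffs (\<lambda>a y. a *\<^sub>R x + D y) p 0"

context
  fixes D :: "'a::real_vector \<Rightarrow> 'a"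
  assumes D: "linear D"
begin

lemma poly_map_0 [simp]: "poly_map 0 D x = 0"
  by (simp add: poly_map_def)

lemma poly_map_pCons [simp]: "poly_map (pCons a p) D x = a *\<^sub>R x + D (poly_map p D x)"
  using linear_0[OF D] by (cases "a = 0 \<and> p = 0") (auto simp: poly_map_def)

lemma poly_map_add: "poly_map (p + q) D x = poly_map p D x + poly_map q D x"
  by (induction p q rule: poly_induct2)
    (simp_all add: linear_add[OF D] algebra_simps)

lemma poly_map_smult: "poly_map (smult c p) D x = c *\<^sub>R poly_map p D x"
  by (induction p) (simp_all add: linear_cmul[OF D] scaleR_add_right)

lemma poly_map_mult: "poly_map (p * q) D x = poly_map p D (poly_map q D x)"
  by (induction p) (simp_all add: poly_map_add poly_map_smult)

lemma poly_map_monom: "poly_map (monom 1 n) D x = (D ^^ n) x"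
  by (induction n) (simp_all add: monom_0 monom_Suc linear_0[OF D])

lemma poly_map_commute:
  assumes "linear T" "\<And>y. T (D y) = D (T y)"
  shows "poly_map p D (T x) = T (poly_map p D x)"
  by (induction p) (simp_all add: assms(2) linear_0[OF assms(1)] linear_add[OF assms(1)]
      linear_cmul[OF assms(1)])

lemma linear_poly_map: "linear (poly_map p D)"
proof (rule linearI)
  fix x y c
  show "poly_map p D (x + y) = poly_map p D x + poly_map p D y"
    by (induction p) (simp_all add: linear_add[OF D] algebra_simps)
  show "poly_map p D (c *\<^sub>R x) = c *\<^sub>R poly_map p D x"
    by (rule poly_map_commute) (simp_all add: linear_cmul[OF D])
qed

text \<open>Finite dimension forces some D^n x into the span of the earlier iterates. Then D^n x =
  q(D) x with q of degree below n, and t^n - q is nonzero and annihilates x.\<close>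

lemma annihilating_poly_vector:
  assumes "finite_dim TYPE('a)"
  shows "\<exists>p. p \<noteq> 0 \<and> poly_map p D x = 0"
proof -
  obtain T :: "'a set" where T: "finite T" "span T = UNIV"
    using assms by (auto simp: finite_dim_def)
  define K where "K n = (\<lambda>i. (D ^^ i) x) ` {..<n}" for n
  have K_Suc: "K (Suc n) = insert ((D ^^ n) x) (K n)" for n
    by (simp add: K_def lessThan_Suc)
  have "\<exists>n. (D ^^ n) x \<in> span (K n)"
  proof (rule ccontr)
    assume "\<not> ?thesis"
    then have no: "(D ^^ n) x \<notin> span (K n)" for n by blast
    have K: "independent (K n) \<and> card (K n) = n" for n
    proof (induction n)
      case 0
      then show ?case by (simp add: K_def independent_empty)
    next
      case (Suc n)
      have "(D ^^ n) x \<notin> K n" using no span_base by blast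
      moreover have "finite (K n)" by (simp add: K_def)
      ultimately show ?case using Suc no by (simp add: K_Suc independent_insertI)
    qed
    have "card (K (Suc (card T))) \<le> card T"
      using independent_span_bound[OF T(1), of "K (Suc (card T))"] K T(2) by simp
    then show False using K by simp
  qed
  then obtain n where n: "(D ^^ n) x \<in> span (K n)" ..
  \<comment> \<open>Bounding q by vanishing coefficients instead of \<open>degree q < n\<close>
    admits the zero polynomial also for n = 0.\<close>
  let ?Q = "{poly_map q D x | q. \<forall>i\<ge>n. coeff q i = 0}"
  have "subspace ?Q"
  proof (rule subspaceI)
    show "0 \<in> ?Q" by (auto intro!: exI[of _ 0])
    show "u + v \<in> ?Q" if uv: "u \<in> ?Q" "v \<in> ?Q" for u v
    proof -
      obtain q r where "u = poly_map q D x" "v = poly_map r D x"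
        "\<forall>i\<ge>n. coeff q i = 0" "\<forall>i\<ge>n. coeff r i = 0" using uv by blast
      then show ?thesis
        by (auto simp: poly_map_add intro!: exI[of _ "q + r"])
    qed
    show "c *\<^sub>R u \<in> ?Q" if u: "u \<in> ?Q" for c u
    proof -
      obtain q where "u = poly_map q D x" "\<forall>i\<ge>n. coeff q i = 0" using u by blast
      then show ?thesis
        by (auto simp: poly_map_smult intro!: exI[of _ "smult c q"])
    qed
  qed
  moreover have "K n \<subseteq> ?Q"
  proof
    fix y assume "y \<in> K n"
    then obtain i where "i < n" "y = (D ^^ i) x" by (auto simp: K_def)
    then show "y \<in> ?Q"
      by (auto simp: poly_map_monom intro!: exI[of _ "monom 1 i"])
  qed
  ultimately have "span (K n) \<subseteq> ?Q" by (rule span_minimal[rotated])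
  then obtain q where q: "(D ^^ n) x = poly_map q D x" "coeff q n = 0"
    using n by blast
  let ?p = "monom 1 n + smult (-1) q"
  have "coeff ?p n = 1" using q(2) by simp
  then have "?p \<noteq> 0" by force
  moreover have "poly_map ?p D x = 0"
    by (simp only: poly_map_add poly_map_smult poly_map_monom q(1)) simp
  ultimately show ?thesis by blast
qed

text \<open>Polynomials in D commute, so the product of annihilators of the vectors of a finite
  spanning set kills each of them.\<close>

lemma annihilating_poly:
  assumes fin: "finite_dim TYPE('a)"
  shows "\<exists>p. p \<noteq> 0 \<and> (\<forall>x. poly_map p D x = 0)"
proof -
  obtain T :: "'a set" where T: "finite T" "span T = UNIV"
    using fin by (auto simp: finite_dim_def)
  have "\<exists>p. p \<noteq> 0 \<and> (\<forall>x\<in>T. poly_map p D x = 0)"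
    using T(1)
  proof (induction T)
    case empty
    show ?case by (auto intro: exI[of _ 1])
  next
    case (insert x F)
    then obtain p where p: "p \<noteq> 0" "\<forall>x\<in>F. poly_map p D x = 0" by blast
    obtain q where q: "q \<noteq> 0" "poly_map q D x = 0"
      using annihilating_poly_vector[OF fin] by blast
    have "poly_map (p * q) D x = 0"
      by (simp add: poly_map_mult q linear_0[OF linear_poly_map])
    moreover have "poly_map (p * q) D y = 0" if "y \<in> F" for y
      using that p(2) by (simp add: poly_map_mult mult.commute[of p] linear_0[OF linear_poly_map])
    ultimately show ?case using p(1) q(1) by (intro exI[of _ "p * q"]) auto
  qed
  then obtain p where p: "p \<noteq> 0" "\<forall>x\<in>T. poly_map p D x = 0" by blast
  have "poly_map p D x = 0" for x
    using linear_eq_0_on_span[OF linear_poly_map, of T p x] p(2) T(2) by auto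
  with p(1) show ?thesis by blast
qed

text \<open>Commutation with B is a derivation, and C = [B, D] commutes with D. Hence [B, p(D)] =
  p'(D) C, as in the chain rule.\<close>

lemma poly_map_pderiv:
  assumes B: "linear B" and C: "linear C"
    and comm: "\<And>x. C x = B (D x) - D (B x)" and CD: "\<And>x. C (D x) = D (C x)"
  shows "B (poly_map p D x) = poly_map p D (B x) + poly_map (pderiv p) D (C x)"
proof (induction p)
  case 0
  show ?case using linear_0[OF B] by simp
next
  case (pCons a p)
  have "B (D y) = D (B y) + C y" for y using comm by simp
  then show ?case
    using pCons poly_map_commute[OF C CD]
    by (simp add: pderiv_pCons poly_map_add linear_add[OF B] linear_cmul[OF B] linear_add[OF C]
        linear_add[OF D] CD)
qed

end

section \<open>Nilpotency of a commutator\<close>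

lemma linear_funpow: "linear (f :: 'a::real_vector \<Rightarrow> 'a) \<Longrightarrow> linear (f ^^ n)"
proof (induction n)
  case 0
  show ?case by (simp add: linear_id[unfolded id_def] id_def linear_iff)
next
  case (Suc n)
  then show ?case using linear_compose[of "f ^^ n" f] by (simp add: o_def)
qed

lemma funpow_commute_at:
  assumes "\<And>x. f (g x) = g (f x)"
  shows "(f ^^ n) (g x) = g ((f ^^ n) x)"
  by (induction n) (simp_all add: assms)

text \<open>If \<open>p(D) C\<^sup>m = 0\<close>, then taking the commutator with \<open>B\<close> and multiplying by \<open>C\<^sup>m\<close> gives
  \<open>p'(D) C\<^bsup>2m + 1\<^esup> = 0\<close>, so the degree of \<open>p\<close> can be lowered to zero.\<close>

lemma nilpotent_commutator:
  fixes B C D :: "'a::real_vector \<Rightarrow> 'a"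
  assumes fin: "finite_dim TYPE('a)"
    and B: "linear B" and C: "linear C" and D: "linear D"
    and comm: "\<And>x. C x = B (D x) - D (B x)" and CD: "\<And>x. C (D x) = D (C x)"
    and ED: "\<And>x. commutator B C (D x) = D (commutator B C x)"
  shows "\<exists>n. \<forall>x. (C ^^ n) x = 0"
proof -
  have Cm: "linear (C ^^ m)" for m by (rule linear_funpow[OF C])
  have CmD: "(C ^^ m) (D x) = D ((C ^^ m) x)" for m x
    by (rule funpow_commute_at) (rule CD)
  define R where "R m = commutator B (C ^^ m)" for m
  have linR: "linear (R m)" for m
    unfolding R_def commutator_def
    by (rule linearI) (simp_all add: linear_add[OF B] linear_add[OF Cm] linear_cmul[OF B]
        linear_cmul[OF Cm] scaleR_diff_right)
  \<comment> \<open>Leibniz rule for [B, C C^m]. By induction it makes every [B, C^m] commute with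
    D, because [B, C] does.\<close>
  have R_Suc: "R (Suc m) x = commutator B C ((C ^^ m) x) + C (R m x)" for m x
    by (simp add: R_def commutator_def linear_diff[OF C])
  have RD: "R m (D x) = D (R m x)" for m x
  proof (induction m)
    case 0
    show ?case by (simp add: R_def commutator_def linear_0[OF D])
  next
    case (Suc m)
    then show ?case by (simp only: R_Suc CmD ED CD linear_add[OF D])
  qed
  have key: "\<exists>n. \<forall>x. (C ^^ n) x = 0"
    if "p \<noteq> 0" "\<forall>x. poly_map p D ((C ^^ m) x) = 0" for p m
    using that
  proof (induction "degree p" arbitrary: p m rule: less_induct)
    case less
    show ?case
    proof (cases "degree p = 0")
      case True
      then obtain a where "p = [:a:]" using degree_eq_zeroE by blast
      with less.prems show ?thesis
        by (auto simp: D linear_0[OF D] intro!: exI[of _ m])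
    next
      case False
      then have "degree (pderiv p) < degree p" "pderiv p \<noteq> 0"
        by (auto simp: pderiv_eq_0_iff degree_pderiv)
      moreover have "\<forall>x. poly_map (pderiv p) D ((C ^^ Suc (m + m)) x) = 0"
      proof
        fix x
        let ?y = "(C ^^ m) x"
        have 0: "poly_map p D ((C ^^ m) z) = 0" for z using less.prems(2) by blast
        have "B ((C ^^ m) ?y) = (C ^^ m) (B ?y) + R m ?y"
          by (simp add: R_def commutator_def)
        \<comment> \<open>Here the second factor C^m in \<open>?y\<close> is used: p(D) moves past
          \<open>R m\<close> and meets C^m x.\<close>
        moreover have "poly_map p D (R m ?y) = 0"
          by (simp only: poly_map_commute[OF D linR[of m] RD[of m]] 0 linear_0[OF linR])
        ultimately have "poly_map p D (B ((C ^^ m) ?y)) = 0"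
          by (simp add: linear_add[OF linear_poly_map[OF D]] 0)
        then show "poly_map (pderiv p) D ((C ^^ Suc (m + m)) x) = 0"
          using poly_map_pderiv[OF D B C comm CD, of p "(C ^^ m) ?y"] 0 linear_0[OF B]
          by (simp add: funpow_add)
      qed
      ultimately show ?thesis by (rule less.hyps)
    qed
  qed
  obtain p where "p \<noteq> 0" "\<forall>x. poly_map p D x = 0"
    using annihilating_poly[OF D fin] by blast
  then show ?thesis using key[of p 0] by simp
qed

section \<open>Null vectors of a Lorentzian metric\<close>

text \<open>If every y orthogonal to w were orthogonal to u, the functional of u would be a multiple
  of that of w, and non-degeneracy would make u a multiple of w.\<close>

lemma metric_separates:
  assumes "is_metric b" "u \<notin> span {w}"
  shows "\<exists>y. b u y = 1 \<and> b w y = 0"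
proof -
  have bil: "bilinear b" and nd: "\<And>x. (\<forall>y. b x y = 0) \<Longrightarrow> x = 0"
    using assms(1) by (auto simp: is_metric_def)
  note simps = bilinear_lsub[OF bil] bilinear_rsub[OF bil] bilinear_lmul[OF bil]
    bilinear_rmul[OF bil]
  have "\<exists>y. b w y = 0 \<and> b u y \<noteq> 0"
  proof (rule ccontr)
    assume "\<not> ?thesis"
    then have imp: "b u y = 0" if "b w y = 0" for y using that by blast
    have "u \<in> span {w}"
    proof (cases "w = 0")
      case True
      then have "b u y = 0" for y using imp bilinear_lzero[OF bil] by simp
      then show ?thesis using nd span_zero by metis
    next
      case False
      then obtain y0 where y0: "b w y0 \<noteq> 0" using nd by blast
      have "b (u - (b u y0 / b w y0) *\<^sub>R w) y = 0" for y
      proof -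
        \<comment> \<open>Subtracting a multiple of \<open>y0\<close> moves y into the kernel of
          \<open>b w\<close>.\<close>
        have "b u (y - (b w y / b w y0) *\<^sub>R y0) = 0"
          by (rule imp) (simp add: simps y0)
        then show ?thesis by (simp add: simps field_simps)
      qed
      then have "u = (b u y0 / b w y0) *\<^sub>R w" using nd by (metis eq_iff_diff_eq_0)
      then show ?thesis using span_base span_mul by (metis insertI1)
    qed
    with assms(2) show False ..
  qed
  then obtain y where y: "b w y = 0" "b u y \<noteq> 0" by blast
  then show ?thesis
    by (intro exI[of _ "(1 / b u y) *\<^sub>R y"]) (simp add: simps)
qed

text \<open>Otherwise u and w span a totally null plane. Together with vectors dual to u and w it
  yields a negative definite plane, against index one.\<close>

lemma lorentzian_null_orthogonal:
  assumes lor: "lorentzian b" and "b u u = 0" "b w w = 0" "b u w = 0" "u \<noteq> 0"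
  shows "w \<in> span {u}"
proof (rule ccontr)
  assume w: "w \<notin> span {u}"
  have met: "is_metric b" using lor by (simp add: lorentzian_def)
  then have bil: "bilinear b" and sym: "\<And>x y. b x y = b y x" by (auto simp: is_metric_def)
  note simps = bilinear_ladd[OF bil] bilinear_radd[OF bil] bilinear_lsub[OF bil]
    bilinear_rsub[OF bil] bilinear_lmul[OF bil] bilinear_rmul[OF bil]
  have "u \<notin> span {w}"
    using w \<open>u \<noteq> 0\<close> span_breakdown_eq[of u w "{}"] span_breakdown_eq[of w u "{}"]
    by (metis in_span_insert insertI1 span_base span_empty singletonD)
  then obtain u' where u': "b u u' = 1" "b w u' = 0" using metric_separates[OF met] by blast
  obtain w' where w': "b w w' = 1" "b u w' = 0" using metric_separates[OF met w] by blast
  have null: "b w u = 0" "b u' u = 1" "b u' w = 0" "b w' w = 1" "b w' u = 0" "b w' u' = b u' w'"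
    using assms u' w' sym by metis+
  \<comment> \<open>The coefficients of u in p and of w in q normalize both squares to -1. The u
    term in q makes p and q orthogonal and leaves the square of q unchanged, since u is null and
    orthogonal to w and \<open>w'\<close>.\<close>
  define p where "p = u' + (- (1 + b u' u') / 2) *\<^sub>R u"
  define q where "q = w' + (- (1 + b w' w') / 2) *\<^sub>R w + (- b u' w') *\<^sub>R u"
  have pq: "b p p = -1" "b q q = -1" "b p q = 0"
    unfolding p_def q_def by (simp_all add: simps null assms u' w' field_simps)
  have qp: "b q p = 0" using pq(3) sym by metis
  have norm: "b (\<alpha> *\<^sub>R p + \<beta> *\<^sub>R q) (\<alpha> *\<^sub>R p + \<beta> *\<^sub>R q) = - (\<alpha>\<^sup>2 + \<beta>\<^sup>2)" for \<alpha> \<beta>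
    by (simp add: simps pq qp power2_eq_square)
  have "b x x < 0" if x: "x \<in> span {p, q}" "x \<noteq> 0" for x
  proof -
    obtain \<alpha> \<beta> where \<alpha>: "x = \<alpha> *\<^sub>R p + \<beta> *\<^sub>R q"
      using x(1) by (auto simp: span_insert algebra_simps span_breakdown_eq)
    then have "\<alpha> \<noteq> 0 \<or> \<beta> \<noteq> 0" using x(2) by auto
    then have "\<alpha>\<^sup>2 + \<beta>\<^sup>2 > 0" by (simp add: sum_power2_gt_zero_iff)
    then show ?thesis unfolding \<alpha> norm by simp
  qed
  then have "negative_definite_on b (span {p, q})"
    by (simp add: negative_definite_on_def)
  then have "dim (span {p, q}) \<le> 1" using lor unfolding lorentzian_def by blast
  moreover have "q \<noteq> 0" using pq(2) bilinear_lzero[OF bil] by force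
  moreover have "p \<notin> span {q}"
  proof
    assume "p \<in> span {q}"
    then obtain c where "p = c *\<^sub>R q" by (auto simp: span_singleton)
    then show False using pq by (simp add: simps)
  qed
  moreover from this have "p \<noteq> q" using span_base by blast
  ultimately show False
    by (simp add: dim_eq_card_independent independent_insert)
qed

section \<open>Skew-symmetric derivations vanishing on the derived algebra\<close>

context lorentzian_data_set
begin

text \<open>By ad-invariance <[W, U], V> = <W, [U, V]>; non-degeneracy finishes.\<close>

lemma orthogonal_derived_central:
  assumes "\<And>U V. gg W (br U V) = 0"
  shows "br W U = 0"
proof (rule gg_nondeg)
  fix V
  have "br W U = - br U W"
    using br_self[of "W + U"] br_self[of W] br_self[of U]
    by (simp add: bilinear_ladd[OF bilinear_br] bilinear_radd[OF bilinear_br] add_eq_0_iff)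
  then have "gg (br W U) V = - gg (br U W) V"
    by (simp add: bilinear_lneg[OF bilinear_gg])
  also have "\<dots> = gg W (br U V)" using ad_invariant[of U] by (simp add: so_def)
  finally show "gg (br W U) V = 0" using assms by simp
qed

lemma rep_linear: "linear (\<pi> Z)"
  using rep_bilinear by (simp add: bilinear_def)

lemma rep_skew: "gv (\<pi> Z X) Y = - gv X (\<pi> Z Y)"
  using rep_so[of Z] by (simp add: so_def)

lemma rep_central_commute:
  assumes "\<And>U. br W U = 0"
  shows "\<pi> W (\<pi> U X) = \<pi> U (\<pi> W X)"
  using fun_cong[OF rep_bracket[of W U], of X] assms
  by (simp add: commutator_def rep_simps)

text \<open>The Lorentzian condition concerns the sum metric, so X and Y are embedded isometrically
  as (0, X) and (0, Y).\<close>

lemma gv_null_orthogonal: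
  assumes "gv X X = 0" "gv Y Y = 0" "gv X Y = 0" "X \<noteq> 0"
  obtains c where "Y = c *\<^sub>R X"
proof -
  have "(0, Y) \<in> span {(0 :: 'g, X)}"
    using assms by (intro lorentzian_null_orthogonal[OF lorentzian_sum])
      (auto simp: orthogonal_sum_def rep_simps zero_prod_def)
  then show thesis using that by (auto simp: span_singleton)
qed

lemma rep_central_nilpotent_zero:
  assumes central: "\<And>U. br W U = 0" and nil: "\<forall>X. (\<pi> W ^^ n) X = 0"
  shows "W = 0"
proof (rule ccontr)
  assume "W \<noteq> 0"
  then have "\<pi> W \<noteq> \<pi> 0" using rep_faithful by (auto dest: injD)
  then have nz: "\<exists>X. \<pi> W X \<noteq> 0" by (auto simp: fun_eq_iff rep_simps)
  let ?C = "\<pi> W"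
  define N where "N = (LEAST n. \<forall>X. (?C ^^ n) X = 0)"
  have N: "\<forall>X. (?C ^^ N) X = 0" unfolding N_def using nil by (rule LeastI)
  have "N \<noteq> 0"
  proof
    assume "N = 0"
    then have "X = 0" for X :: 'v using N by simp
    then show False using nz by blast
  qed
  moreover have "N \<noteq> 1" using N nz by auto
  \<comment> \<open>The bound k \<ge> 1 matters: it gives 2k \<ge> N, so that S = C^k squares to
    zero.\<close>
  ultimately obtain k where k: "N = Suc k" "k \<ge> 1" by (cases N) auto
  define S where "S = ?C ^^ k"
  have "k < N" using k by simp
  then obtain X where X: "S X \<noteq> 0"
    unfolding N_def S_def by (blast dest: not_less_Least)
  have adj: "gv ((?C ^^ m) Y) Z = (-1) ^ m * gv Y ((?C ^^ m) Z)" for m Y Z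
    by (induction m arbitrary: Y Z)
      (simp_all add: rep_skew funpow_swap1 bilinear_rneg[OF bilinear_gv])
  define \<epsilon> :: real where "\<epsilon> = (-1) ^ k"
  have adjS: "gv (S Y) Z = \<epsilon> * gv Y (S Z)" for Y Z
    using adj[of k] by (simp add: S_def \<epsilon>_def)
  have "S (S Y) = 0" for Y
  proof -
    obtain j where "k + k = j + N" using k by (intro that[of "k - 1"]) simp
    then have "S (S Y) = (?C ^^ j) ((?C ^^ N) Y)"
      unfolding S_def by (metis funpow_add comp_apply)
    then show ?thesis using N linear_0[OF linear_funpow[OF rep_linear]] by metis
  qed
  then have null: "gv (S Y) (S Z) = 0" for Y Z
    by (simp add: adjS rep_simps)
  have line: "\<exists>c. S Y = c *\<^sub>R S X" for Y
    using gv_null_orthogonal[OF null null null X] by blast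
  \<comment> \<open>Some Y pairs nontrivially with S X. Moving S onto Y replaces it by S Y, a
    multiple of S X.\<close>
  have SX: "gv (S X) X \<noteq> 0"
  proof -
    obtain Y where Y: "gv (S X) Y \<noteq> 0" using gv_nondeg X by blast
    obtain c where "S Y = c *\<^sub>R S X" using line by blast
    then show ?thesis
      using Y adjS[of X Y] gv_sym[of X "S X"] by (auto simp: bilinear_rmul[OF bilinear_gv])
  qed
  \<comment> \<open>Symmetry of the metric rules out the sign -1, so S is self-adjoint.\<close>
  have "gv (S X) X = \<epsilon> * gv (S X) X" using adjS[of X X] by (metis gv_sym)
  then have \<epsilon>: "\<epsilon> = 1" using SX by simp
  have "\<pi> U (S X) = 0" for U
  proof -
    have comm: "S (\<pi> U X) = \<pi> U (S X)"
      unfolding S_def by (rule funpow_commute_at) (rule rep_central_commute[OF central])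
    obtain c where c: "\<pi> U (S X) = c *\<^sub>R S X" using line[of "\<pi> U X"] comm by auto
    \<comment> \<open>Self-adjointness of S and skewness of \<open>\<pi> U\<close>, which commute,
      show that this number equals its own negative. Hence c = 0.\<close>
    have "c * gv (S X) X = gv (\<pi> U (S X)) X"
      by (simp add: c bilinear_lmul[OF bilinear_gv])
    also have "\<dots> = - gv X (\<pi> U (S X))"
      using rep_skew adjS[of X "\<pi> U X"] by (simp add: \<epsilon> comm)
    also have "\<dots> = - (c * gv (S X) X)"
      by (simp add: c bilinear_rmul[OF bilinear_gv] gv_sym)
    finally show ?thesis using SX c by simp
  qed
  then have "S X \<in> (\<Inter>Z. {X. \<pi> Z X = 0})" by blast
  then show False using rep_no_common_kernel X by blast
qed

lemma h_aut_derived_zero: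
  assumes A: "A \<in> so gg" and B: "B \<in> so gv" and AB: "\<And>Z. commutator B (\<pi> Z) = \<pi> (A Z)"
    and A0: "\<And>Z. Z \<in> derived_algebra br \<Longrightarrow> A Z = 0"
  shows "A Z = 0"
proof -
  have central: "br (A Y) U = 0" for Y U
  proof (rule orthogonal_derived_central)
    fix U V
    have "br U V \<in> derived_algebra br" by (auto simp: derived_algebra_def intro!: span_base)
    then show "gg (A Y) (br U V) = 0" using A A0 by (simp add: so_def rep_simps)
  qed
  have "\<exists>n. \<forall>X. (\<pi> (A Z) ^^ n) X = 0"
  proof (rule nilpotent_commutator[OF finite_dim_v _ rep_linear rep_linear])
    show "linear B" using B by (simp add: so_def)
    show "\<pi> (A Z) X = B (\<pi> Z X) - \<pi> Z (B X)" for X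
      using fun_cong[OF AB[of Z], of X] by (simp add: commutator_def)
    show "\<pi> (A Z) (\<pi> Z X) = \<pi> Z (\<pi> (A Z) X)" for X
      by (rule rep_central_commute[OF central])
    \<comment> \<open>[B, \<pi>(A Z)] = \<pi>(A (A Z)), and A (A Z) is central like every value of
      A.\<close>
    show "commutator B (\<pi> (A Z)) (\<pi> Z X) = \<pi> Z (commutator B (\<pi> (A Z)) X)" for X
      by (simp add: AB rep_central_commute[OF central])
  qed
  then show ?thesis using rep_central_nilpotent_zero[OF central] by blast
qed

end

theorem theorem7p2:
  fixes br :: "'g::real_vector \<Rightarrow> 'g \<Rightarrow> 'g"
    and gg :: "'g \<Rightarrow> 'g \<Rightarrow> real"
    and gv :: "'v::real_vector \<Rightarrow> 'v \<Rightarrow> real"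
    and \<pi> :: "'g \<Rightarrow> 'v \<Rightarrow> 'v"
  assumes "lorentzian_data_set br gg gv \<pi>"
  shows "u_aut br gg gv \<pi> = (\<lambda>B. ((\<lambda>_. 0), B)) ` (End_rep \<pi> \<inter> so gv)
    \<and> End_rep \<pi> \<inter> so gv = {B \<in> so gv. \<forall>Z. commutator B (\<pi> Z) = (\<lambda>_. 0)}"
proof -
  interpret lorentzian_data_set br gg gv \<pi> by (rule assms)
  have End: "End_rep \<pi> \<inter> so gv = {B \<in> so gv. \<forall>Z. commutator B (\<pi> Z) = (\<lambda>_. 0)}"
    by (auto simp: End_rep_def so_def)
  have pi0: "\<pi> 0 = (\<lambda>_. 0)" by (simp add: fun_eq_iff rep_simps)
  have zero: "(\<lambda>_. 0) \<in> so gg" by (simp add: so_def rep_simps linear_iff)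
  have "(A, B) \<in> u_aut br gg gv \<pi> \<longleftrightarrow>
      A = (\<lambda>_. 0) \<and> B \<in> so gv \<and> (\<forall>Z. commutator B (\<pi> Z) = (\<lambda>_. 0))" for A B
  proof -
    have "A = (\<lambda>_. 0)" if "(A, B) \<in> u_aut br gg gv \<pi>"
      using that h_aut_derived_zero[of A B] by (auto simp: u_aut_def map_prod_in_h_aut)
    \<comment> \<open>Once A = 0, the condition [B, \<pi> Z] = \<pi>(A Z) says exactly that B
      commutes with \<pi> Z.\<close>
    then show ?thesis
      using zero by (auto simp: u_aut_def map_prod_in_h_aut pi0)
  qed
  then have "u_aut br gg gv \<pi> = (\<lambda>B. ((\<lambda>_. 0), B)) ` (End_rep \<pi> \<inter> so gv)"
    unfolding End by auto
  with End show ?thesis by blast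
qed

end
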